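(* Let $n,p,q\ge1$ and $x=(x_{ijk})\in\mathbb{C}^n\otimes\mathbb{C}^p\otimes\mathbb{C}^q$. For $i=1,\dots,n$ let $S_i=(x_{ijk})_{1\le j\le p,\,1\le k\le q}\in M_{p,q}$ and $R_i=S_i^t\in M_{q,p}$. If $$d(R_iR_j^*,R_{i'}R_{j'}^* )<d(S_iS_j^*,S_{i'}S_{j'}^* )$$ for some $i,j,i',j'\in\{1,\dots,n\}$, then there is no TPCP map $L:M_q\to M_p$ satisfying $L(R_uR_v^* )=S_uS_v^*$ for all $1\le u,v\le n$.
   Context: $M_{a,b}$ is the set of $a\times b$ complex matrices and $M_a=M_{a,a}$; $A^t$ is the transpose and $A^*$ the conjugate transpose. For a square matrix $\sigma$, the trace norm $\mathrm{tr}|\sigma|$ is the sum of the singular values of $\sigma$, and for square matrices $\rho,\sigma$ of the same size (not necessarily Hermitian) $d(\rho,\sigma)=\frac12\mathrm{tr}|\rho-\sigma|$. A TPCP map is a trace-preserving completely positive linear map; equivalently, a map $M_a\to M_b$ of the form $Y\mapsto\sum_{j=1}^r G_jYG_j^*$ with $G_j\in M_{b,a}$ and $\sum_jG_j^*G_j=I_a$. *)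

theory Defs
  imports "Jordan_Normal_Form.Schur_Decomposition"
begin

text \<open>The singular values of A are the nonnegative square roots of the eigenvalues of
  \<open>A\<^sup>* A\<close>, counted with algebraic multiplicity (these eigenvalues are nonnegative reals, so
  taking real parts loses nothing).\<close>

definition singular_values :: "complex mat \<Rightarrow> real multiset" where
  "singular_values A = image_mset (\<lambda>z. sqrt (Re z)) (proots (char_poly (mat_adjoint A * A)))"

definition trace_norm :: "complex mat \<Rightarrow> real" where
  "trace_norm A = sum_mset (singular_values A)"

definition trace_dist :: "complex mat \<Rightarrow> complex mat \<Rightarrow> real" where
  "trace_dist A B = trace_norm (A - B) / 2"

text \<open>The order on \<^typ>\<open>complex\<close> is the partial one: \<open>0 \<le> z\<close> says that z is real and
  nonnegative.\<close>

definition psd_mat :: "nat \<Rightarrow> complex mat \<Rightarrow> bool" where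
  "psd_mat m X \<longleftrightarrow> X \<in> carrier_mat m m \<and> mat_adjoint X = X \<and>
     (\<forall>v \<in> carrier_vec m. 0 \<le> (X *\<^sub>v v) \<bullet>c v)"

text \<open>An element of \<open>M\<^sub>k \<otimes> M\<^sub>a\<close> is a \<open>k a \<times> k a\<close> matrix, viewed as a
  \<open>k \<times> k\<close> array of \<open>a \<times> a\<close> blocks; \<open>id\<^sub>k \<otimes> L\<close> applies L to each block.\<close>

definition mat_block :: "nat \<Rightarrow> complex mat \<Rightarrow> nat \<Rightarrow> nat \<Rightarrow> complex mat" where
  "mat_block a X s t = mat a a (\<lambda>(i, j). X $$ (s * a + i, t * a + j))"

definition ampliation ::
    "nat \<Rightarrow> nat \<Rightarrow> nat \<Rightarrow> (complex mat \<Rightarrow> complex mat) \<Rightarrow> complex mat \<Rightarrow> complex mat" where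
  "ampliation k a b L X = mat (k * b) (k * b)
     (\<lambda>(r, c). L (mat_block a X (r div b) (c div b)) $$ (r mod b, c mod b))"

definition linear_mat_map :: "nat \<Rightarrow> nat \<Rightarrow> (complex mat \<Rightarrow> complex mat) \<Rightarrow> bool" where
  "linear_mat_map a b L \<longleftrightarrow>
     L \<in> carrier_mat a a \<rightarrow> carrier_mat b b \<and>
     (\<forall>X \<in> carrier_mat a a. \<forall>Y \<in> carrier_mat a a. L (X + Y) = L X + L Y) \<and>
     (\<forall>c. \<forall>X \<in> carrier_mat a a. L (c \<cdot>\<^sub>m X) = c \<cdot>\<^sub>m L X)"

definition completely_positive :: "nat \<Rightarrow> nat \<Rightarrow> (complex mat \<Rightarrow> complex mat) \<Rightarrow> bool" where
  "completely_positive a b L \<longleftrightarrow>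
     (\<forall>k X. psd_mat (k * a) X \<longrightarrow> psd_mat (k * b) (ampliation k a b L X))"

definition mat_trace :: "complex mat \<Rightarrow> complex" where
  "mat_trace A = (\<Sum>i<dim_row A. A $$ (i, i))"

definition trace_preserving :: "nat \<Rightarrow> (complex mat \<Rightarrow> complex mat) \<Rightarrow> bool" where
  "trace_preserving a L \<longleftrightarrow> (\<forall>X \<in> carrier_mat a a. mat_trace (L X) = mat_trace X)"

definition tpcp :: "nat \<Rightarrow> nat \<Rightarrow> (complex mat \<Rightarrow> complex mat) \<Rightarrow> bool" where
  "tpcp a b L \<longleftrightarrow> linear_mat_map a b L \<and> completely_positive a b L \<and> trace_preserving a L"

text \<open>A tensor in \<open>\<complex>\<^sup>n \<otimes> \<complex>\<^sup>p \<otimes> \<complex>\<^sup>q\<close> is its array of coordinates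
  \<open>x i j k\<close>, with indices counted from 0: \<open>i < n\<close>, \<open>j < p\<close>, \<open>k < q\<close>.
  Values outside that range are never used.\<close>

definition slice_S :: "nat \<Rightarrow> nat \<Rightarrow> (nat \<Rightarrow> nat \<Rightarrow> nat \<Rightarrow> complex) \<Rightarrow> nat \<Rightarrow> complex mat" where
  "slice_S p q x i = mat p q (\<lambda>(j, k). x i j k)"

definition slice_R :: "nat \<Rightarrow> nat \<Rightarrow> (nat \<Rightarrow> nat \<Rightarrow> nat \<Rightarrow> complex) \<Rightarrow> nat \<Rightarrow> complex mat" where
  "slice_R p q x i = transpose_mat (slice_S p q x i)"

end

theory Submission
  imports Defs "Jordan_Normal_Form.Spectral_Radius"
begin

text \<open>A TPCP map does not increase the trace norm of an arbitrary, not necessarily Hermitian,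
  matrix A, so it cannot increase the distance between two of the products in question. Indeed
  \<open>2 tr|A|\<close> is the least value of \<open>tr P + tr Q\<close> over all positive semidefinite block matrices
  with rows \<open>(P, A)\<close> and \<open>(A\<^sup>*, Q)\<close>. If \<open>A = U S V\<^sup>*\<close> is a singular value
  decomposition, the minimum is attained at \<open>P = U S U\<^sup>*\<close>, \<open>Q = V S V\<^sup>*\<close>, and the
  lower bound comes from compressing the block matrix with the column \<open>(U, -V)\<close>. Applying
  \<open>id\<^sub>2 \<otimes> L\<close> to a minimizer for A gives an admissible block matrix for \<open>L A\<close> with
  the same trace.\<close>

subsection \<open>Adjoints and traces\<close>

lemma mat_adjoint_dim [simp]:
  "dim_row (mat_adjoint A) = dim_col A" "dim_col (mat_adjoint A) = dim_row A"
  by (simp_all add: mat_adjoint_def)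

lemma mat_adjoint_index [simp]:
  fixes A :: "complex mat"
  assumes "i < dim_col A" "j < dim_row A"
  shows "mat_adjoint A $$ (i, j) = cnj (A $$ (j, i))"
  using assms by (simp add: mat_adjoint_def mat_of_rows_index)

lemma mat_adjoint_carrier [simp]: "A \<in> carrier_mat m n \<Longrightarrow> mat_adjoint A \<in> carrier_mat n m"
  by auto

lemma mat_adjoint_adjoint [simp]: "mat_adjoint (mat_adjoint A) = (A :: complex mat)"
  by (rule eq_matI) auto

lemma mat_adjoint_mult:
  fixes A B :: "complex mat"
  assumes "A \<in> carrier_mat m n" "B \<in> carrier_mat n k"
  shows "mat_adjoint (A * B) = mat_adjoint B * mat_adjoint A"
  using assms by (intro eq_matI) (auto simp: scalar_prod_def mult.commute)

lemma mat_adjoint_minus: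
  fixes A B :: "complex mat"
  assumes "A \<in> carrier_mat m n" "B \<in> carrier_mat m n"
  shows "mat_adjoint (A - B) = mat_adjoint A - mat_adjoint B"
  using assms by (intro eq_matI) auto

lemma mat_adjoint_uminus: "mat_adjoint (- A) = - mat_adjoint (A :: complex mat)"
  by (intro eq_matI) auto

lemma mat_adjoint_one [simp]: "mat_adjoint (1\<^sub>m n :: complex mat) = 1\<^sub>m n"
  by (rule eq_matI) auto

lemma mat_adjoint_zero [simp]: "mat_adjoint (0\<^sub>m m n :: complex mat) = 0\<^sub>m n m"
  by (rule eq_matI) auto

lemma mat_adjoint_mat_diag: "mat_adjoint (mat_diag n f) = mat_diag n (\<lambda>i. cnj (f i))"
  by (rule eq_matI) (auto simp: mat_diag_def)

lemma mat_adjoint_four_block: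
  fixes A B C D :: "complex mat"
  assumes "A \<in> carrier_mat m1 n1" "B \<in> carrier_mat m1 n2"
    "C \<in> carrier_mat m2 n1" "D \<in> carrier_mat m2 n2"
  shows "mat_adjoint (four_block_mat A B C D) =
    four_block_mat (mat_adjoint A) (mat_adjoint C) (mat_adjoint B) (mat_adjoint D)"
  using assms by (intro eq_matI) auto

text \<open>Serves to read off, from the self-adjointness of a block matrix, that its off-diagonal
  blocks are adjoint to each other.\<close>

lemma four_block_mat_eq_upper_right:
  assumes "A \<in> carrier_mat m1 n1" "B \<in> carrier_mat m1 n2"
    "C \<in> carrier_mat m2 n1" "D \<in> carrier_mat m2 n2"
    and "A' \<in> carrier_mat m1 n1" "B' \<in> carrier_mat m1 n2"
    "C' \<in> carrier_mat m2 n1" "D' \<in> carrier_mat m2 n2"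
    and eq: "four_block_mat A B C D = four_block_mat A' B' C' D'"
  shows "B = B'"
proof (rule eq_matI)
  fix i j assume ij: "i < dim_row B'" "j < dim_col B'"
  have "four_block_mat A B C D $$ (i, n1 + j) = four_block_mat A' B' C' D' $$ (i, n1 + j)"
    by (simp add: eq)
  then show "B $$ (i, j) = B' $$ (i, j)"
    using ij assms(1-8) by auto
qed (use assms in auto)

section \<open>Cyclicity and additivity of the trace\<close>

lemma mat_trace_mult_commute:
  assumes "A \<in> carrier_mat m n" "B \<in> carrier_mat n m"
  shows "mat_trace (A * B) = mat_trace (B * A)"
proof -
  have "mat_trace (A * B) = (\<Sum>i<m. \<Sum>j<n. A $$ (i, j) * B $$ (j, i))"
    using assms by (auto simp: mat_trace_def scalar_prod_def lessThan_atLeast0 intro!: sum.cong)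
  also have "\<dots> = (\<Sum>j<n. \<Sum>i<m. B $$ (j, i) * A $$ (i, j))"
    by (subst sum.swap) (simp add: mult.commute)
  also have "\<dots> = mat_trace (B * A)"
    using assms by (auto simp: mat_trace_def scalar_prod_def lessThan_atLeast0 intro!: sum.cong)
  finally show ?thesis .
qed

lemma mat_trace_add:
  "A \<in> carrier_mat n n \<Longrightarrow> B \<in> carrier_mat n n \<Longrightarrow> mat_trace (A + B) = mat_trace A + mat_trace B"
  by (auto simp: mat_trace_def sum.distrib)

lemma mat_trace_minus:
  "A \<in> carrier_mat n n \<Longrightarrow> B \<in> carrier_mat n n \<Longrightarrow> mat_trace (A - B) = mat_trace A - mat_trace B"
  by (auto simp: mat_trace_def sum_subtractf)

lemma mat_trace_uminus: "A \<in> carrier_mat n n \<Longrightarrow> mat_trace (- A) = - mat_trace A"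
  by (auto simp: mat_trace_def sum_negf)

lemma mat_trace_mat_diag: "mat_trace (mat_diag n f) = (\<Sum>i<n. f i)"
  by (simp add: mat_trace_def mat_diag_def)

lemma mat_trace_four_block:
  assumes "A \<in> carrier_mat m m" "D \<in> carrier_mat n n"
  shows "mat_trace (four_block_mat A B C D) = mat_trace A + mat_trace D"
proof -
  have "(\<Sum>i<m + n. four_block_mat A B C D $$ (i, i)) =
    (\<Sum>i<m. four_block_mat A B C D $$ (i, i)) + (\<Sum>i<n. four_block_mat A B C D $$ (m + i, m + i))"
    using sum.shift_bounds_nat_ivl[of "\<lambda>i. four_block_mat A B C D $$ (i, i)" 0 m n]
    by (simp add: lessThan_atLeast0 sum.atLeastLessThan_concat[of 0 m "m + n", symmetric] add.commute)
  then show ?thesis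
    using assms by (auto simp: mat_trace_def)
qed

subsection \<open>Spectral theorem and singular values\<close>

lemma mult_block_diagonal:
  fixes A A' B B' :: "complex mat"
  assumes "A \<in> carrier_mat m m" "A' \<in> carrier_mat m m" "B \<in> carrier_mat n n" "B' \<in> carrier_mat n n"
  shows "four_block_mat A (0\<^sub>m m n) (0\<^sub>m n m) B * four_block_mat A' (0\<^sub>m m n) (0\<^sub>m n m) B' =
    four_block_mat (A * A') (0\<^sub>m m n) (0\<^sub>m n m) (B * B')"
  using assms mult_carrier_mat[of A m m A' m] mult_carrier_mat[of B n n B' n]
  by (subst mult_four_block_mat[of _ m m _ n _ n _ _ m _ n]) auto

text \<open>Complete \<open>v\<close> to a basis and apply Gram-Schmidt, which keeps
  \<open>v\<close> as first vector and makes the columns orthogonal but not of unit length.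
  Rescaling the columns makes the matrix unitary; \<open>c\<close> records the rescaling of
  \<open>v\<close>.\<close>

lemma unitary_first_column:
  fixes v :: "complex vec"
  assumes v: "v \<in> carrier_vec n" and v0: "v \<noteq> 0\<^sub>v n"
  obtains W c where "W \<in> carrier_mat n n" "mat_adjoint W * W = 1\<^sub>m n" "col W 0 = c \<cdot>\<^sub>v v"
proof -
  interpret cof_vec_space n "TYPE(complex)" .
  define b where "b = basis_completion v"
  define ws where "ws = gram_schmidt n b"
  define W where "W = mat_of_cols n ws"
  from basis_completion[OF v v0, folded b_def]
  have dist_b: "distinct b" and indep: "\<not> lin_dep (set b)" and b: "set b \<subseteq> carrier_vec n"
    and hdb: "hd b = v" and len_b: "length b = n" by auto
  have n: "0 < n" using v v0 by (cases n) auto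
  obtain vs where bv: "b = v # vs" using hdb len_b n by (cases b) auto
  from gram_schmidt_result[OF b dist_b indep refl, folded ws_def]
  have ws: "set ws \<subseteq> carrier_vec n" "corthogonal ws" "length ws = n"
    by (auto simp: len_b)
  have hdws: "hd ws = v"
    using gram_schmidt_hd[OF v, of vs] by (simp add: ws_def bv)
  have W: "W \<in> carrier_mat n n" using ws by (auto simp: W_def)
  have col0: "col W 0 = v"
    using ws n hdws by (cases ws) (auto simp: W_def v)
  let ?B = "mat_adjoint W * W"
  \<comment> \<open>Orthogonality of the columns says that the Gram matrix \<open>?B\<close> is
    diagonal with nonzero diagonal entries; those entries are the squared column norms
    \<open>d i\<close>.\<close>
  have "corthogonal_mat W" unfolding W_def by (rule orthogonal_mat_of_cols[OF ws])
  then have diag: "\<And>i j. i < n \<Longrightarrow> j < n \<Longrightarrow> i \<noteq> j \<Longrightarrow> ?B $$ (i, j) = 0"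
    and nz: "\<And>i. i < n \<Longrightarrow> ?B $$ (i, i) \<noteq> 0"
    using W by (auto simp: corthogonal_mat_def Let_def diagonal_mat_def)
  define d where "d i = (\<Sum>k<n. (cmod (W $$ (k, i)))\<^sup>2)" for i
  have Bii: "?B $$ (i, i) = of_real (d i)" if "i < n" for i
    using W that
    by (auto simp: d_def scalar_prod_def lessThan_atLeast0 complex_norm_square mult.commute
        simp del: of_real_power intro!: sum.cong)
  have dpos: "0 < d i" if "i < n" for i
  proof -
    have "d i \<noteq> 0" using nz[OF that] Bii[OF that] by (metis of_real_0)
    moreover have "0 \<le> d i" by (simp add: d_def sum_nonneg)
    ultimately show ?thesis by simp
  qed
  \<comment> \<open>Right multiplication by \<open>N\<close> divides column i by its norm.\<close>
  define N where "N = mat_diag n (\<lambda>i. complex_of_real (1 / sqrt (d i)))"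
  have N: "N \<in> carrier_mat n n" by (simp add: N_def)
  have "mat_adjoint (W * N) * (W * N) = N * (?B * N)"
    using W N by (simp add: mat_adjoint_mult assoc_mult_mat[of _ n n _ n _ n])
      (simp add: N_def mat_adjoint_mat_diag)
  also have "\<dots> = 1\<^sub>m n"
  proof (rule eq_matI)
    fix i j assume "i < dim_row (1\<^sub>m n :: complex mat)" "j < dim_col (1\<^sub>m n :: complex mat)"
    then have ij: "i < n" "j < n" by auto
    have "(N * (?B * N)) $$ (i, j) =
      complex_of_real (1 / sqrt (d i)) * (?B $$ (i, j) * complex_of_real (1 / sqrt (d j)))"
      using W ij mult_carrier_mat[of "mat_adjoint W" n n W n] unfolding N_def
      by (simp add: mult_carrier_mat[of _ n n _ n] mat_diag_mult_right[of _ n] mat_diag_mult_left[of _ n n] del: index_mult_mat(1))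
    also have "\<dots> = 1\<^sub>m n $$ (i, j)"
    proof (cases "i = j")
      case True
      have "complex_of_real (1 / sqrt (d i)) * (complex_of_real (d i) * complex_of_real (1 / sqrt (d i)))
        = complex_of_real (d i / (sqrt (d i) * sqrt (d i)))"
        by (simp only: of_real_mult of_real_divide of_real_1) simp
      also have "\<dots> = 1" using dpos[OF ij(1)] by simp
      finally show ?thesis using True ij by (simp add: Bii del: index_mult_mat(1))
    next
      case False
      then show ?thesis using ij by (simp add: diag del: index_mult_mat(1))
    qed
    finally show "(N * (?B * N)) $$ (i, j) = 1\<^sub>m n $$ (i, j)" .
  qed (use W N in auto)
  finally have un: "mat_adjoint (W * N) * (W * N) = 1\<^sub>m n" .
  have "col (W * N) 0 = complex_of_real (1 / sqrt (d 0)) \<cdot>\<^sub>v v"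
    using W n v col0[symmetric] unfolding N_def
    by (intro eq_vecI) (auto simp: mat_diag_mult_right[of _ n])
  then show ?thesis using that[of "W * N"] W N un by auto
qed

text \<open>Deflation: a unitary whose first column is a multiple of an eigenvector splits off a 1 x
  1 block, and the remaining block is again self-adjoint. That the eigenvalues \<open>f\<close> are
  real and nonnegative is obtained later, for Gram matrices only.\<close>

lemma unitary_diagonalization:
  fixes H :: "complex mat"
  assumes "H \<in> carrier_mat n n" "mat_adjoint H = H"
  shows "\<exists>V f. V \<in> carrier_mat n n \<and> mat_adjoint V * V = 1\<^sub>m n \<and>
    mat_adjoint V * H * V = mat_diag n f"
  using assms
proof (induction n arbitrary: H)
  case 0
  then show ?case
    by (intro exI[of _ "1\<^sub>m 0"] exI[of _ "\<lambda>_. 0"]) (auto simp: mat_diag_def)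
next
  case (Suc n)
  note H = Suc.prems
  obtain e where "e \<in> spectrum H" using spectrum_non_empty[OF H(1)] by auto
  then obtain v where "eigenvector H v e" by (auto simp: spectrum_def eigenvalue_def)
  then have v: "v \<in> carrier_vec (Suc n)" "v \<noteq> 0\<^sub>v (Suc n)" and ev: "H *\<^sub>v v = e \<cdot>\<^sub>v v"
    using H by (auto simp: eigenvector_def)
  obtain W c where W: "W \<in> carrier_mat (Suc n) (Suc n)" and WW: "mat_adjoint W * W = 1\<^sub>m (Suc n)"
    and col0: "col W 0 = c \<cdot>\<^sub>v v"
    using unitary_first_column[OF v] by metis
  define H' where "H' = mat_adjoint W * (H * W)"
  have H': "H' \<in> carrier_mat (Suc n) (Suc n)" using W H by (auto simp: H'_def)
  have herm: "mat_adjoint H' = H'"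
    using W H by (simp add: H'_def mat_adjoint_mult[of _ "Suc n" "Suc n" _ "Suc n"]
        assoc_mult_mat[of _ "Suc n" "Suc n" _ "Suc n" _ "Suc n"])
  have ev': "H *\<^sub>v col W 0 = e \<cdot>\<^sub>v col W 0"
    using H v ev by (simp add: col0 mult_mat_vec[of _ "Suc n" "Suc n"] smult_smult_assoc mult.commute)
  have first: "H' $$ (i, 0) = (if i = 0 then e else 0)" if i: "i < Suc n" for i
  proof -
    have "H' $$ (i, 0) = row (mat_adjoint W) i \<bullet> (H *\<^sub>v col W 0)"
      using W H i by (simp add: H'_def mult_mat_vec_def)
    also have "\<dots> = e * (mat_adjoint W * W) $$ (i, 0)"
    proof -
      have "row (mat_adjoint W) i \<in> carrier_vec (Suc n)" "col W 0 \<in> carrier_vec (Suc n)"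
        using W by (auto intro: carrier_vecI)
      then have "row (mat_adjoint W) i \<bullet> (e \<cdot>\<^sub>v col W 0) = e * (row (mat_adjoint W) i \<bullet> col W 0)"
        by (rule scalar_prod_smult_distrib)
      then show ?thesis unfolding ev' using W i by simp
    qed
    finally show ?thesis using i unfolding WW by simp
  qed
  \<comment> \<open>The eigenvector clears the first column; self-adjointness transfers this to the
    first row.\<close>
  have first': "H' $$ (0, i) = 0" if "i < Suc n" "i \<noteq> 0" for i
  proof -
    have "H' $$ (0, i) = cnj (H' $$ (i, 0))"
      using that H' by (subst herm[symmetric]) auto
    then show ?thesis using first[OF that(1)] that by simp
  qed
  define E where "E = mat 1 1 (\<lambda>_. e)"
  define K where "K = mat n n (\<lambda>(i, j). H' $$ (Suc i, Suc j))"
  have K: "K \<in> carrier_mat n n" by (simp add: K_def)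
  have block: "H' = four_block_mat E (0\<^sub>m 1 n) (0\<^sub>m n 1) K"
    using H' by (intro eq_matI) (auto simp: E_def K_def first first')
  have "mat_adjoint K = K"
  proof (rule eq_matI)
    fix i j assume "i < dim_row K" "j < dim_col K"
    then show "mat_adjoint K $$ (i, j) = K $$ (i, j)"
      using H' arg_cong[OF herm, of "\<lambda>M. M $$ (Suc i, Suc j)"] by (simp add: K_def)
  qed (auto simp: K_def)
  from Suc.IH[OF K this] obtain V f where V: "V \<in> carrier_mat n n"
    and VV: "mat_adjoint V * V = 1\<^sub>m n" and VK: "mat_adjoint V * K * V = mat_diag n f"
    by auto
  define Z where "Z = four_block_mat (1\<^sub>m 1) (0\<^sub>m 1 n) (0\<^sub>m n 1) V"
  have Z: "Z \<in> carrier_mat (Suc n) (Suc n)"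
    using four_block_carrier_mat[of "1\<^sub>m 1" 1 1 V n n] V by (simp add: Z_def)
  have adjZ: "mat_adjoint Z = four_block_mat (1\<^sub>m 1) (0\<^sub>m 1 n) (0\<^sub>m n 1) (mat_adjoint V)"
    using V unfolding Z_def by (subst mat_adjoint_four_block[of _ 1 1 _ n _ n]) auto
  have ZZ: "mat_adjoint Z * Z = 1\<^sub>m (Suc n)"
    unfolding adjZ unfolding Z_def
    using V VV by (subst mult_block_diagonal) auto
  have E: "E \<in> carrier_mat 1 1" by (simp add: E_def)
  have "mat_adjoint Z * H' * Z = four_block_mat E (0\<^sub>m 1 n) (0\<^sub>m n 1) (mat_diag n f)"
  proof -
    have VK': "mat_adjoint V * K \<in> carrier_mat n n" using V K by auto
    have "mat_adjoint Z * H' = four_block_mat (1\<^sub>m 1 * E) (0\<^sub>m 1 n) (0\<^sub>m n 1) (mat_adjoint V * K)"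
      unfolding adjZ block using V K E by (intro mult_block_diagonal) auto
    also have "1\<^sub>m 1 * E = E" using E by simp
    finally have "mat_adjoint Z * H' * Z =
        four_block_mat (E * 1\<^sub>m 1) (0\<^sub>m 1 n) (0\<^sub>m n 1) (mat_adjoint V * K * V)"
      unfolding Z_def using V VK' E by (simp only:) (intro mult_block_diagonal, auto)
    then show ?thesis using E by (simp add: VK)
  qed
  \<comment> \<open>The new eigenvalue takes index 0 and the entries of \<open>f\<close> move up by
    one.\<close>
  also have "\<dots> = mat_diag (Suc n) (case_nat e f)"
    by (intro eq_matI) (auto simp: E_def mat_diag_def split: nat.splits)
  finally have diag: "mat_adjoint Z * H' * Z = mat_diag (Suc n) (case_nat e f)" .
  let ?V = "W * Z"
  note assoc = assoc_mult_mat[of _ "Suc n" "Suc n" _ "Suc n" _ "Suc n"]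
    mult_carrier_mat[of _ "Suc n" "Suc n" _ "Suc n"]
  have adjV: "mat_adjoint ?V = mat_adjoint Z * mat_adjoint W"
    using W Z by (rule mat_adjoint_mult)
  have "mat_adjoint ?V * ?V = mat_adjoint Z * ((mat_adjoint W * W) * Z)"
    unfolding adjV using W Z by (simp add: assoc)
  then have "mat_adjoint ?V * ?V = 1\<^sub>m (Suc n)" using Z ZZ by (simp add: WW)
  moreover have "mat_adjoint ?V * H * ?V = mat_diag (Suc n) (case_nat e f)"
    unfolding adjV diag[symmetric] H'_def using W Z H by (simp add: assoc)
  ultimately show ?case using W Z by (intro exI[of _ ?V] exI[of _ "case_nat e f"]) auto
qed

section \<open>Singular value decomposition and its relation to the trace norm\<close>

lemma proots_linear_factors: "proots (\<Prod>a\<leftarrow>xs. [:- a, 1:]) = mset (xs :: complex list)"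
proof (induction xs)
  case (Cons a xs)
  have "(\<Prod>a\<leftarrow>xs. [:- a, 1:]) \<noteq> 0" by (auto simp: prod_list_zero_iff)
  then show ?case using Cons proots_linear_factor[of "- a"]
    by (simp add: proots_mult del: mult_pCons_left)
qed simp

lemma sum_mset_image_upt: "sum_mset (image_mset g (mset [0..<n])) = (\<Sum>i<n. g i)" for g :: "nat \<Rightarrow> real"
  by (simp add: lessThan_atLeast0 sum_unfold_sum_mset)

text \<open>U is only a partial isometry: its columns at vanishing singular values are 0, being
  obtained from \<open>A V\<close> by dividing by \<open>s i\<close>, where \<open>1 / 0 = 0\<close>.\<close>

lemma singular_value_decomposition:
  fixes A :: "complex mat"
  assumes A: "A \<in> carrier_mat n n"
  obtains U V and s :: "nat \<Rightarrow> real" where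
    "U \<in> carrier_mat n n" "V \<in> carrier_mat n n" "\<And>i. 0 \<le> s i"
    "mat_adjoint V * V = 1\<^sub>m n"
    "U * (mat_adjoint U * U) = U"
    "mat_adjoint U * U * mat_diag n (\<lambda>i. complex_of_real (s i)) = mat_diag n (\<lambda>i. complex_of_real (s i))"
    "A = U * mat_diag n (\<lambda>i. complex_of_real (s i)) * mat_adjoint V"
    "trace_norm A = (\<Sum>i<n. s i)"
proof -
  let ?H = "mat_adjoint A * A"
  note assoc = assoc_mult_mat[of _ n n _ n _ n] mult_carrier_mat[of _ n n _ n]
  have H: "?H \<in> carrier_mat n n" "mat_adjoint ?H = ?H"
    using A by (auto simp: mat_adjoint_mult[of _ n n _ n])
  obtain V f where V: "V \<in> carrier_mat n n" and VV: "mat_adjoint V * V = 1\<^sub>m n"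
    and diag: "mat_adjoint V * ?H * V = mat_diag n f"
    using unitary_diagonalization[OF H] by auto
  have VV': "V * mat_adjoint V = 1\<^sub>m n"
    using mat_mult_left_right_inverse[of "mat_adjoint V" n V] V VV by auto
  define Y where "Y = A * V"
  have Y: "Y \<in> carrier_mat n n" using A V by (simp add: Y_def)
  \<comment> \<open>The singular values appear as the column norms of \<open>Y = A * V\<close>,
    since \<open>mat_adjoint Y * Y\<close> is the diagonalized \<open>?H\<close>.\<close>
  define s where "s i = sqrt (\<Sum>k<n. (cmod (Y $$ (k, i)))\<^sup>2)" for i
  have s0: "0 \<le> s i" for i by (simp add: s_def sum_nonneg)
  \<comment> \<open>Columns of norm 0 vanish, so \<open>Y * D = Y\<close> below although
    \<open>D\<close> erases them.\<close>
  have Y_zero: "Y $$ (k, i) = 0" if "s i = 0" "k < n" for k i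
    using that by (simp add: s_def sum_nonneg_eq_0_iff)
  have YY: "mat_adjoint Y * Y = mat_diag n f"
    using A V unfolding diag[symmetric] Y_def by (simp add: mat_adjoint_mult[of _ n n _ n] assoc)
  \<comment> \<open>Here the eigenvalues of \<open>?H\<close> turn out to be nonnegative
    reals.\<close>
  have f: "f i = complex_of_real (s i * s i)" if "i < n" for i
  proof -
    have "f i = (mat_adjoint Y * Y) $$ (i, i)"
      unfolding YY using that by (simp add: mat_diag_def)
    also have "\<dots> = complex_of_real (\<Sum>k<n. (cmod (Y $$ (k, i)))\<^sup>2)"
      using Y that by (auto simp: scalar_prod_def lessThan_atLeast0 complex_norm_square mult.commute
          simp del: of_real_power intro!: sum.cong)
    also have "(\<Sum>k<n. (cmod (Y $$ (k, i)))\<^sup>2) = s i * s i"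
      by (simp add: s_def sum_nonneg)
    finally show ?thesis .
  qed
  have mat_diag_cong: "mat_diag n g = mat_diag n h" if "\<And>i. i < n \<Longrightarrow> g i = h i" for g h :: "nat \<Rightarrow> complex"
    using that by (auto simp: mat_diag_def intro!: eq_matI)
  define N where "N = mat_diag n (\<lambda>i. complex_of_real (1 / s i))"
  \<comment> \<open>The projection onto the indices with nonzero singular value. It equals both
    \<open>mat_adjoint U * U\<close> and \<open>N * S\<close>, and it fixes \<open>N\<close> and
    \<open>S\<close>; all identities for the partial isometry \<open>U\<close> come from
    this.\<close>
  define D where "D = mat_diag n (\<lambda>i. if s i = 0 then 0 else 1 :: complex)"
  define S where "S = mat_diag n (\<lambda>i. complex_of_real (s i))"
  define U where "U = Y * N"
  have N: "N \<in> carrier_mat n n" "D \<in> carrier_mat n n" "S \<in> carrier_mat n n"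
    by (simp_all add: N_def D_def S_def)
  have U: "U \<in> carrier_mat n n" using Y N by (simp add: U_def)
  have "mat_adjoint U * U = N * ((mat_adjoint Y * Y) * N)"
    using Y N by (simp add: U_def mat_adjoint_mult[of _ n n _ n] assoc)
      (simp add: N_def mat_adjoint_mat_diag)
  also have "\<dots> = D"
    unfolding YY by (simp add: N_def D_def, rule mat_diag_cong) (simp add: f)
  finally have UU: "mat_adjoint U * U = D" .
  have ND: "N * D = N" by (simp add: N_def D_def, rule mat_diag_cong) simp
  have UUU: "U * (mat_adjoint U * U) = U"
    unfolding UU using Y N ND by (simp add: U_def assoc)
  have UUS: "mat_adjoint U * U * S = S"
    unfolding UU D_def S_def by (simp, rule mat_diag_cong) simp
  have NS: "N * S = D" by (simp add: N_def S_def D_def)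
  have "U * S = Y * D"
    using Y N by (simp add: U_def assoc NS)
  also have "\<dots> = Y"
    unfolding D_def using Y by (subst mat_diag_mult_right[of _ n]) (auto intro!: eq_matI simp: Y_zero)
  finally have US: "U * S = Y" .
  have dec: "A = U * S * mat_adjoint V"
    unfolding US using A V VV' by (simp add: Y_def assoc)
  have "similar_mat_wit ?H (mat_diag n f) V (mat_adjoint V)"
  proof (rule similar_mat_witI[of _ _ n])
    have "V * mat_diag n f * mat_adjoint V = (V * mat_adjoint V) * ?H * (V * mat_adjoint V)"
      using V A H(1) unfolding diag[symmetric] by (simp add: assoc)
    then show "?H = V * mat_diag n f * mat_adjoint V" using A H(1) by (simp add: VV')
  qed (use V VV VV' H(1) in auto)
  then have "char_poly ?H = char_poly (mat_diag n f)"
    by (intro char_poly_similar) (auto simp: similar_mat_def)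
  also have "\<dots> = (\<Prod>a\<leftarrow>diag_mat (mat_diag n f). [:- a, 1:])"
    by (rule char_poly_upper_triangular[of _ n]) (auto simp: mat_diag_def)
  also have "diag_mat (mat_diag n f) = map f [0..<n]"
    by (simp add: diag_mat_def) (simp add: mat_diag_def)
  \<comment> \<open>The characteristic polynomial of \<open>?H\<close> splits with roots
    \<open>f i\<close>, so the multiset of its roots is indexed by i < n with the right
    multiplicities.\<close>
  finally have "singular_values A = image_mset (\<lambda>i. sqrt (Re (f i))) (mset [0..<n])"
    unfolding singular_values_def by (simp only: proots_linear_factors mset_map) (simp add: multiset.map_comp comp_def)
  then have "trace_norm A = (\<Sum>i<n. sqrt (Re (f i)))"
    unfolding trace_norm_def by (simp only: sum_mset_image_upt)
  also have "\<dots> = (\<Sum>i<n. s i)" using s0 by (intro sum.cong) (auto simp: f)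
  finally have tn: "trace_norm A = (\<Sum>i<n. s i)" .
  show ?thesis
    by (rule that[of U V s, OF U V s0 VV UUU UUS[unfolded S_def] dec[unfolded S_def] tn])
qed

subsection \<open>The block characterization of the trace norm\<close>

text \<open>The quadratic form at \<open>v\<close> is the squared norm of
  \<open>u = mat_adjoint W *\<^sub>v v\<close>; exchanging the two sums exhibits it as a sum of
  terms \<open>u $ j * cnj (u $ j)\<close>.\<close>

lemma psd_mat_mult_adjoint:
  fixes W :: "complex mat"
  assumes W: "W \<in> carrier_mat m k"
  shows "psd_mat m (W * mat_adjoint W)"
  unfolding psd_mat_def
proof (intro conjI ballI)
  show "W * mat_adjoint W \<in> carrier_mat m m" using W by auto
  show "mat_adjoint (W * mat_adjoint W) = W * mat_adjoint W"
    using W by (simp add: mat_adjoint_mult[of _ m k _ m])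
  fix v :: "complex vec" assume v: "v \<in> carrier_vec m"
  define u where "u = mat_adjoint W *\<^sub>v v"
  have u: "u \<in> carrier_vec k" using W by (intro carrier_vecI) (simp add: u_def)
  have "(W * mat_adjoint W *\<^sub>v v) \<bullet>c v = (W *\<^sub>v u) \<bullet>c v"
    using W v by (simp add: u_def assoc_mult_mat_vec[of _ m k _ m])
  also have "\<dots> = (\<Sum>i<m. \<Sum>j<k. W $$ (i, j) * u $ j * cnj (v $ i))"
  proof -
    have "(W *\<^sub>v u) \<bullet>c v = (\<Sum>i<m. (\<Sum>j<k. W $$ (i, j) * u $ j) * cnj (v $ i))"
      using W v u by (simp add: scalar_prod_def lessThan_atLeast0)
    then show ?thesis by (simp add: sum_distrib_right)
  qed
  also have "\<dots> = (\<Sum>j<k. \<Sum>i<m. W $$ (i, j) * u $ j * cnj (v $ i))"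
    by (rule sum.swap)
  also have "\<dots> = (\<Sum>j<k. u $ j * cnj (u $ j))"
  proof (rule sum.cong)
    fix j assume "j \<in> {..<k}"
    then have "cnj (u $ j) = (\<Sum>i<m. W $$ (i, j) * cnj (v $ i))"
      using W v by (simp add: u_def scalar_prod_def lessThan_atLeast0)
    then show "(\<Sum>i<m. W $$ (i, j) * u $ j * cnj (v $ i)) = u $ j * cnj (u $ j)"
      by (simp add: sum_distrib_left mult_ac)
  qed simp
  also have "0 \<le> \<dots>"
    using conjugate_square_positive[where 'a = complex] by (intro sum_nonneg) simp
  finally show "0 \<le> (W * mat_adjoint W *\<^sub>v v) \<bullet>c v" .
qed

text \<open>Each diagonal entry of the congruent matrix is the quadratic form of \<open>X\<close> at
  a column of \<open>Z\<close>.\<close>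

lemma psd_mat_trace_congruence:
  assumes X: "psd_mat m X" and Z: "Z \<in> carrier_mat m k"
  shows "0 \<le> mat_trace (mat_adjoint Z * X * Z)"
proof -
  have X': "X \<in> carrier_mat m m" using X by (simp add: psd_mat_def)
  have "(mat_adjoint Z * X * Z) $$ (j, j) = (X *\<^sub>v col Z j) \<bullet>c col Z j" if "j < k" for j
  proof -
    have "(mat_adjoint Z * X * Z) $$ (j, j) = (mat_adjoint Z * (X * Z)) $$ (j, j)"
      using X' Z by (simp add: assoc_mult_mat[of _ k m _ m _ k])
    also have "\<dots> = (X *\<^sub>v col Z j) \<bullet>c col Z j"
      using X' Z that by (simp add: scalar_prod_def mult.commute)
    finally show ?thesis .
  qed
  moreover have "0 \<le> (X *\<^sub>v col Z j) \<bullet>c col Z j" if "j < k" for j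
    using X Z that by (auto simp: psd_mat_def)
  ultimately show ?thesis
    using Z by (auto simp: mat_trace_def intro!: sum_nonneg)
qed

text \<open>Compression of the block matrix by the block column with entries \<open>Y\<close> and
  \<open>Z\<close>, padded with zeros to the square matrix \<open>?M\<close>. The choice
  \<open>Z\<close> = 0 gives positivity of the corner \<open>P\<close>; the choice (U, -V) gives the
  trace norm bound.\<close>

lemma psd_block_trace:
  assumes X: "psd_mat (2 * n) (four_block_mat P A B Q)"
    and PQ: "P \<in> carrier_mat n n" "A \<in> carrier_mat n n" "B \<in> carrier_mat n n" "Q \<in> carrier_mat n n"
    and Y: "Y \<in> carrier_mat n n" and Z: "Z \<in> carrier_mat n n"
  shows "0 \<le> mat_trace (mat_adjoint Y * P * Y) + mat_trace (mat_adjoint Z * B * Y) +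
    (mat_trace (mat_adjoint Y * A * Z) + mat_trace (mat_adjoint Z * Q * Z))"
proof -
  let ?O = "0\<^sub>m n n :: complex mat"
  let ?M = "four_block_mat Y ?O Z ?O" and ?X = "four_block_mat P A B Q"
  note cl = mult_carrier_mat[of _ n n _ n] add_carrier_mat[of _ n n]
  have M: "?M \<in> carrier_mat (2 * n) (2 * n)"
    using four_block_carrier_mat[OF Y zero_carrier_mat[of n n]] by (simp add: mult_2)
  have adjM: "mat_adjoint ?M = four_block_mat (mat_adjoint Y) (mat_adjoint Z) ?O ?O"
    using Y Z by (subst mat_adjoint_four_block[of _ n n _ n _ n]) auto
  let ?R = "mat_adjoint Y * P + mat_adjoint Z * B" and ?S = "mat_adjoint Y * A + mat_adjoint Z * Q"
  have MX: "mat_adjoint ?M * ?X = four_block_mat ?R ?S ?O ?O"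
    unfolding adjM using PQ Y Z by (subst mult_four_block_mat[of _ n n _ n _ n _ _ n _ n]) auto
  have "mat_adjoint ?M * ?X * ?M = four_block_mat (?R * Y + ?S * Z) ?O ?O ?O"
    unfolding MX using PQ Y Z by (subst mult_four_block_mat[of _ n n _ n _ n _ _ n _ n]) (auto simp: cl)
  then have "mat_trace (mat_adjoint ?M * ?X * ?M) = mat_trace (?R * Y + ?S * Z) + mat_trace ?O"
    using PQ Y Z by (simp add: mat_trace_four_block[of _ n _ n] cl)
  also have "mat_trace ?O = 0" by (simp add: mat_trace_def)
  also have "?R * Y + ?S * Z = (mat_adjoint Y * P * Y + mat_adjoint Z * B * Y) +
      (mat_adjoint Y * A * Z + mat_adjoint Z * Q * Z)"
    using PQ Y Z by (simp add: add_mult_distrib_mat[of _ n n _ _ n] cl)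
  finally show ?thesis
    using psd_mat_trace_congruence[OF X M] PQ Y Z by (simp add: mat_trace_add[of _ n] cl)
qed

text \<open>The trace lost is that of the compression of P by the projection \<open>1 - U U\<^sup>*\<close>.\<close>

lemma trace_compression_le:
  fixes P U :: "complex mat"
  assumes P: "P \<in> carrier_mat n n" and U: "U \<in> carrier_mat n n"
    and pos: "\<And>Y. Y \<in> carrier_mat n n \<Longrightarrow> 0 \<le> mat_trace (mat_adjoint Y * P * Y)"
    and UU: "U * (mat_adjoint U * U) = U"
  shows "mat_trace (mat_adjoint U * P * U) \<le> mat_trace P"
proof -
  note cl = mult_carrier_mat[of _ n n _ n]
  note assoc = assoc_mult_mat[of _ n n _ n _ n]
  define K where "K = U * mat_adjoint U"
  define E where "E = 1\<^sub>m n - K"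
  have K: "K \<in> carrier_mat n n" using U by (auto simp: K_def)
  have E: "E \<in> carrier_mat n n" using K by (simp add: E_def minus_carrier_mat)
  have adjK: "mat_adjoint K = K" using U by (simp add: K_def mat_adjoint_mult[of _ n n _ n])
  have adjE: "mat_adjoint E = E"
    using K by (simp add: E_def mat_adjoint_minus[of _ n n] adjK)
  \<comment> \<open>The partial isometry identity makes \<open>K\<close>, and hence
    \<open>E\<close>, a self-adjoint idempotent.\<close>
  have "K * K = (U * (mat_adjoint U * U)) * mat_adjoint U"
    using U by (simp add: K_def assoc cl)
  then have KK: "K * K = K" by (simp add: UU K_def)
  have "E * E = E - K * E"
    using K E by (subst E_def, subst minus_mult_distrib_mat[of _ n n _ _ n]) auto
  also have "K * E = K - K * K"
    using K by (simp add: E_def mult_minus_distrib_mat[of _ n n _ n])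
  also have "E - (K - K * K) = E"
    using K E unfolding KK by (intro eq_matI) auto
  finally have EE: "E * E = E" .
  \<comment> \<open>By cyclicity and \<open>E * E = E\<close> this is the trace of
    \<open>P * E\<close>, which is the trace of \<open>P\<close> less that of its compression by
    \<open>U\<close>.\<close>
  have "mat_trace (mat_adjoint E * P * E) = mat_trace (P * E)"
    using mat_trace_mult_commute[of "E * P" n n E] mat_trace_mult_commute[of E n n P] P E
    by (simp add: adjE assoc_mult_mat[of E n n E n P n, symmetric] EE cl)
  also have "P * E = P - P * K"
    using P K by (simp add: E_def mult_minus_distrib_mat[of _ n n _ n])
  also have "mat_trace (P - P * K) = mat_trace P - mat_trace (P * K)"
    using P K by (simp add: mat_trace_minus[of _ n] cl)
  also have "mat_trace (P * K) = mat_trace (mat_adjoint U * P * U)"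
    using mat_trace_mult_commute[of "P * U" n n "mat_adjoint U"] P U
    by (simp add: K_def assoc cl)
  finally show ?thesis using pos[OF E] by simp
qed

text \<open>The lower bound. Compressing by (U, -V) turns both off-diagonal blocks into
  \<open>- S\<close>. On the diagonal, the unitary \<open>V\<close> preserves the trace of
  \<open>Q\<close>, while the partial isometry \<open>U\<close> can only decrease that of
  \<open>P\<close>, which is the favourable direction.\<close>

lemma trace_norm_le_psd_block:
  assumes X: "psd_mat (2 * n) (four_block_mat P A B Q)"
    and PQ: "P \<in> carrier_mat n n" "A \<in> carrier_mat n n" "B \<in> carrier_mat n n" "Q \<in> carrier_mat n n"
  shows "2 * trace_norm A \<le> Re (mat_trace P + mat_trace Q)"
proof -
  note cl = mult_carrier_mat[of _ n n _ n]
  note assoc = assoc_mult_mat[of _ n n _ n _ n]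
  obtain U V and s :: "nat \<Rightarrow> real" where U: "U \<in> carrier_mat n n" and V: "V \<in> carrier_mat n n"
    and VV: "mat_adjoint V * V = 1\<^sub>m n"
    and UUU: "U * (mat_adjoint U * U) = U"
    and UUS': "mat_adjoint U * U * mat_diag n (\<lambda>i. complex_of_real (s i)) = mat_diag n (\<lambda>i. complex_of_real (s i))"
    and dec: "A = U * mat_diag n (\<lambda>i. complex_of_real (s i)) * mat_adjoint V"
    and tn: "trace_norm A = (\<Sum>i<n. s i)"
    by (rule singular_value_decomposition[OF PQ(2)]) blast
  define S where "S = mat_diag n (\<lambda>i. complex_of_real (s i))"
  have S: "S \<in> carrier_mat n n" by (simp add: S_def)
  have adjS: "mat_adjoint S = S" by (simp add: S_def mat_adjoint_mat_diag)
  have UUS: "mat_adjoint U * U * S = S" using UUS' by (simp only: S_def)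
  have "mat_adjoint U * A * V = (mat_adjoint U * U * S) * (mat_adjoint V * V)"
    unfolding dec using U V S by (simp add: S_def[symmetric] assoc cl)
  then have UAV: "mat_adjoint U * A * V = S" using S by (simp add: UUS VV)
  \<comment> \<open>Self-adjointness of the block matrix forces \<open>B\<close> to be the adjoint
    of \<open>A\<close>, so its compression is the adjoint of that of \<open>A\<close>, again
    \<open>S\<close>.\<close>
  have "four_block_mat (mat_adjoint P) (mat_adjoint B) (mat_adjoint A) (mat_adjoint Q) = four_block_mat P A B Q"
    using X PQ by (simp add: psd_mat_def mat_adjoint_four_block[of _ n n _ n _ n])
  then have BA: "mat_adjoint B = A"
    using four_block_mat_eq_upper_right[of "mat_adjoint P" n n "mat_adjoint B" n "mat_adjoint A" n "mat_adjoint Q" P A B Q] PQ by simp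
  have "mat_adjoint (mat_adjoint V * B * U) = S"
    using U V PQ by (simp add: mat_adjoint_mult[of _ n n _ n] cl BA UAV[symmetric] assoc)
  then have VBU: "mat_adjoint V * B * U = S"
    by (metis adjS mat_adjoint_adjoint)
  have trS: "mat_trace S = complex_of_real (trace_norm A)"
    by (simp add: S_def mat_trace_mat_diag tn)
  let ?O = "0\<^sub>m n n :: complex mat"
  have tr0: "mat_trace ?O = 0" by (simp add: mat_trace_def)
  have pos: "0 \<le> mat_trace (mat_adjoint Y * P * Y)" if Y: "Y \<in> carrier_mat n n" for Y
    using psd_block_trace[OF X PQ Y zero_carrier_mat[of n n]] Y PQ by (simp add: tr0 cl)
  have trP: "mat_trace (mat_adjoint U * P * U) \<le> mat_trace P"
    by (rule trace_compression_le[OF PQ(1) U pos UUU])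
  have VV': "V * mat_adjoint V = 1\<^sub>m n"
    using mat_mult_left_right_inverse[of "mat_adjoint V" n V] V VV by auto
  have "mat_trace (mat_adjoint V * Q * V) = mat_trace (V * (mat_adjoint V * Q))"
    using V PQ by (intro mat_trace_mult_commute[of _ n n]) (auto simp: cl)
  also have "V * (mat_adjoint V * Q) = Q"
    using V PQ by (simp add: assoc[symmetric] VV')
  finally have trQ: "mat_trace (mat_adjoint V * Q * V) = mat_trace Q" .
  have "0 \<le> mat_trace (mat_adjoint U * P * U) + mat_trace (- S) + (mat_trace (- S) + mat_trace Q)"
    using psd_block_trace[OF X PQ U uminus_carrier_mat[OF V]] U V PQ
    by (simp add: mat_adjoint_uminus uminus_mult_left_mat uminus_mult_right_mat VBU UAV trQ)
  also have "\<dots> \<le> mat_trace P + mat_trace (- S) + (mat_trace (- S) + mat_trace Q)"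
    using trP by (intro add_right_mono)
  \<comment> \<open>The chain above lives in the partial order of the complex numbers; only its real
    part is kept.\<close>
  finally have "0 \<le> Re \<dots>" by (simp add: less_eq_complex_def)
  then show ?thesis using S by (simp add: mat_trace_uminus[of _ n] trS)
qed

text \<open>The minimizer is \<open>?M\<close> times its adjoint, where \<open>?M\<close> has first
  block column (U T, V T) and \<open>T\<close> is the square root of \<open>S\<close>. Positivity is
  then automatic, and both diagonal blocks have the trace of \<open>S\<close>.\<close>

lemma psd_block_attaining_trace_norm:
  assumes A: "A \<in> carrier_mat n n"
  obtains P B Q where "P \<in> carrier_mat n n" "B \<in> carrier_mat n n" "Q \<in> carrier_mat n n"
    "psd_mat (2 * n) (four_block_mat P A B Q)" "Re (mat_trace P + mat_trace Q) = 2 * trace_norm A"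
proof -
  note cl = mult_carrier_mat[of _ n n _ n]
  note assoc = assoc_mult_mat[of _ n n _ n _ n]
  obtain U V and s :: "nat \<Rightarrow> real" where U: "U \<in> carrier_mat n n" and V: "V \<in> carrier_mat n n"
    and s: "\<And>i. 0 \<le> s i" and VV: "mat_adjoint V * V = 1\<^sub>m n"
    and UUU: "U * (mat_adjoint U * U) = U"
    and UUS': "mat_adjoint U * U * mat_diag n (\<lambda>i. complex_of_real (s i)) = mat_diag n (\<lambda>i. complex_of_real (s i))"
    and dec: "A = U * mat_diag n (\<lambda>i. complex_of_real (s i)) * mat_adjoint V"
    and tn: "trace_norm A = (\<Sum>i<n. s i)"
    by (rule singular_value_decomposition[OF A]) blast
  define S where "S = mat_diag n (\<lambda>i. complex_of_real (s i))"
  define T where "T = mat_diag n (\<lambda>i. complex_of_real (sqrt (s i)))"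
  have S: "S \<in> carrier_mat n n" "T \<in> carrier_mat n n" by (simp_all add: S_def T_def)
  have adjT: "mat_adjoint T = T" by (simp add: T_def mat_adjoint_mat_diag)
  have TT: "T * T = S"
    by (simp add: T_def S_def of_real_mult[symmetric] s del: of_real_mult)
  have UUS: "mat_adjoint U * U * S = S" using UUS' by (simp only: S_def)
  have trS: "mat_trace S = complex_of_real (trace_norm A)"
    by (simp add: S_def mat_trace_mat_diag tn)
  have mult: "Y * T * mat_adjoint (Z * T) = Y * S * mat_adjoint Z"
    if "Y \<in> carrier_mat n n" "Z \<in> carrier_mat n n" for Y Z
  proof -
    have "Y * T * mat_adjoint (Z * T) = Y * (T * T) * mat_adjoint Z"
      using that S by (simp add: mat_adjoint_mult[of _ n n _ n] adjT assoc cl)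
    then show ?thesis by (simp add: TT)
  qed
  let ?O = "0\<^sub>m n n :: complex mat"
  let ?M = "four_block_mat (U * T) ?O (V * T) ?O"
  have UT: "U * T \<in> carrier_mat n n" "V * T \<in> carrier_mat n n" using U V S by (simp_all add: cl)
  have M: "?M \<in> carrier_mat (2 * n) (2 * n)"
    using four_block_carrier_mat[OF UT(1) zero_carrier_mat[of n n]] by (simp add: mult_2)
  have adjM: "mat_adjoint ?M = four_block_mat (mat_adjoint (U * T)) (mat_adjoint (V * T)) ?O ?O"
    using UT by (subst mat_adjoint_four_block[of _ n n _ n _ n]) auto
  have "?M * mat_adjoint ?M = four_block_mat (U * T * mat_adjoint (U * T) + ?O * ?O)
      (U * T * mat_adjoint (V * T) + ?O * ?O) (V * T * mat_adjoint (U * T) + ?O * ?O)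
      (V * T * mat_adjoint (V * T) + ?O * ?O)"
    unfolding adjM using UT by (intro mult_four_block_mat[of _ n n _ n _ n _ _ n _ n]) auto
  also have "\<dots> = four_block_mat (U * S * mat_adjoint U) A (V * S * mat_adjoint U) (V * S * mat_adjoint V)"
    using U V S by (simp add: mult cl dec S_def[symmetric])
  finally have psd: "psd_mat (2 * n)
      (four_block_mat (U * S * mat_adjoint U) A (V * S * mat_adjoint U) (V * S * mat_adjoint V))"
    using psd_mat_mult_adjoint[OF M] by simp
  have "mat_trace (U * S * mat_adjoint U) = mat_trace (mat_adjoint U * (U * S))"
    using U S by (intro mat_trace_mult_commute[of _ n n]) (auto simp: cl)
  \<comment> \<open>\<open>U\<close> need not be unitary, but \<open>mat_adjoint U * U\<close> acts
    as the identity wherever \<open>S\<close> is nonzero.\<close>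
  also have "mat_adjoint U * (U * S) = S" using U S UUS by (simp add: assoc)
  finally have trU: "mat_trace (U * S * mat_adjoint U) = mat_trace S" .
  have "mat_trace (V * S * mat_adjoint V) = mat_trace (mat_adjoint V * (V * S))"
    using V S by (intro mat_trace_mult_commute[of _ n n]) (auto simp: cl)
  also have "mat_adjoint V * (V * S) = S" using V S VV by (simp add: assoc[symmetric])
  finally have trV: "mat_trace (V * S * mat_adjoint V) = mat_trace S" .
  show ?thesis
    using that[OF _ _ _ psd] U V S by (simp add: cl trU trV trS)
qed

subsection \<open>Contractivity\<close>

text \<open>Translates the index arithmetic of \<open>ampliation\<close> with k = 2 into block
  matrices, the form in which complete positivity is applied.\<close>

lemma ampliation_four_block:
  assumes L: "L \<in> carrier_mat a a \<rightarrow> carrier_mat b b"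
    and PQ: "P \<in> carrier_mat a a" "A \<in> carrier_mat a a" "B \<in> carrier_mat a a" "Q \<in> carrier_mat a a"
  shows "ampliation 2 a b L (four_block_mat P A B Q) = four_block_mat (L P) (L A) (L B) (L Q)"
proof -
  let ?X = "four_block_mat P A B Q"
  have blocks: "mat_block a ?X 0 0 = P" "mat_block a ?X 0 (Suc 0) = A"
    "mat_block a ?X (Suc 0) 0 = B" "mat_block a ?X (Suc 0) (Suc 0) = Q"
    using PQ by (auto simp: mat_block_def intro!: eq_matI)
  have LPQ: "L P \<in> carrier_mat b b" "L A \<in> carrier_mat b b" "L B \<in> carrier_mat b b" "L Q \<in> carrier_mat b b"
    using L PQ by auto
  \<comment> \<open>An index in the second half of the range belongs to block 1, at offset
    \<open>r - b\<close>.\<close>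
  have div: "r div b = Suc 0" "r mod b = r - b" if "r < 2 * b" "\<not> r < b" for r
    using that by (auto simp: div_if mod_if)
  show ?thesis
  proof (rule eq_matI)
    fix i j assume "i < dim_row (four_block_mat (L P) (L A) (L B) (L Q))"
      "j < dim_col (four_block_mat (L P) (L A) (L B) (L Q))"
    then have ij: "i < 2 * b" "j < 2 * b" using LPQ by auto
    show "ampliation 2 a b L ?X $$ (i, j) = four_block_mat (L P) (L A) (L B) (L Q) $$ (i, j)"
      using ij LPQ by (cases "i < b"; cases "j < b") (auto simp: ampliation_def blocks div)
  qed (use LPQ in \<open>auto simp: ampliation_def\<close>)
qed

lemma tpcp_trace_norm_contraction:
  assumes L: "tpcp a b L" and A: "A \<in> carrier_mat a a"
  shows "trace_norm (L A) \<le> trace_norm A"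
proof -
  obtain P B Q where PQ: "P \<in> carrier_mat a a" "B \<in> carrier_mat a a" "Q \<in> carrier_mat a a"
    and psd: "psd_mat (2 * a) (four_block_mat P A B Q)"
    and tr: "Re (mat_trace P + mat_trace Q) = 2 * trace_norm A"
    by (rule psd_block_attaining_trace_norm[OF A])
  have car: "L \<in> carrier_mat a a \<rightarrow> carrier_mat b b"
    and tp: "\<And>X. X \<in> carrier_mat a a \<Longrightarrow> mat_trace (L X) = mat_trace X"
    using L by (auto simp: tpcp_def linear_mat_map_def trace_preserving_def)
  have "psd_mat (2 * b) (ampliation 2 a b L (four_block_mat P A B Q))"
    using L psd by (auto simp: tpcp_def completely_positive_def)
  then have "psd_mat (2 * b) (four_block_mat (L P) (L A) (L B) (L Q))"
    using ampliation_four_block[OF car] PQ A by simp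
  \<comment> \<open>The image block matrix need not be minimal for \<open>L A\<close>; the lower
    bound holds for every positive block matrix, and trace preservation carries its right side back
    to \<open>P\<close> and \<open>Q\<close>.\<close>
  then have "2 * trace_norm (L A) \<le> Re (mat_trace (L P) + mat_trace (L Q))"
    by (rule trace_norm_le_psd_block) (use car PQ A in auto)
  then show ?thesis using tr tp PQ by simp
qed

lemma linear_mat_map_minus:
  assumes L: "linear_mat_map a b L" and X: "X \<in> carrier_mat a a" and Y: "Y \<in> carrier_mat a a"
  shows "L (X - Y) = L X - L Y"
proof -
  have LXY: "L X \<in> carrier_mat b b" "L Y \<in> carrier_mat b b"
    using L X Y by (auto simp: linear_mat_map_def)
  have "X - Y = X + (-1) \<cdot>\<^sub>m Y" using X Y by (intro eq_matI) auto
  then have "L (X - Y) = L X + (-1) \<cdot>\<^sub>m L Y"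
    using L X Y by (simp add: linear_mat_map_def)
  then show ?thesis using LXY by (auto intro!: eq_matI)
qed

lemma tpcp_trace_dist_contraction:
  assumes "tpcp a b L" "X \<in> carrier_mat a a" "Y \<in> carrier_mat a a"
  shows "trace_dist (L X) (L Y) \<le> trace_dist X Y"
  using tpcp_trace_norm_contraction[OF assms(1), of "X - Y"] linear_mat_map_minus[of a b L X Y] assms
  by (simp add: trace_dist_def tpcp_def minus_carrier_mat)

theorem corollary6p4:
  fixes n p q :: nat and x :: "nat \<Rightarrow> nat \<Rightarrow> nat \<Rightarrow> complex"
  assumes "1 \<le> n" and "1 \<le> p" and "1 \<le> q"
    and "\<exists>i<n. \<exists>j<n. \<exists>i'<n. \<exists>j'<n.
           trace_dist (slice_R p q x i * mat_adjoint (slice_R p q x j))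
                      (slice_R p q x i' * mat_adjoint (slice_R p q x j'))
         < trace_dist (slice_S p q x i * mat_adjoint (slice_S p q x j))
                      (slice_S p q x i' * mat_adjoint (slice_S p q x j'))"
  shows "\<nexists>L. tpcp q p L \<and>
           (\<forall>u<n. \<forall>v<n. L (slice_R p q x u * mat_adjoint (slice_R p q x v))
                     = slice_S p q x u * mat_adjoint (slice_S p q x v))"
proof
  let ?R = "\<lambda>u v. slice_R p q x u * mat_adjoint (slice_R p q x v)"
  let ?S = "\<lambda>u v. slice_S p q x u * mat_adjoint (slice_S p q x v)"
  assume "\<exists>L. tpcp q p L \<and> (\<forall>u<n. \<forall>v<n. L (?R u v) = ?S u v)"
  then obtain L where L: "tpcp q p L" and LR: "\<And>u v. u < n \<Longrightarrow> v < n \<Longrightarrow> L (?R u v) = ?S u v"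
    by blast
  obtain i j i' j' where ij: "i < n" "j < n" "i' < n" "j' < n"
    and less: "trace_dist (?R i j) (?R i' j') < trace_dist (?S i j) (?S i' j')"
    using assms(4) by blast
  have "?R u v \<in> carrier_mat q q" for u v
    by (intro carrier_matI) (simp_all add: slice_R_def slice_S_def)
  \<comment> \<open>Since \<open>L\<close> sends the two R-products to the corresponding S-products,
    contraction contradicts the assumed strict inequality.\<close>
  from tpcp_trace_dist_contraction[OF L this this, of i j i' j'] less show False
    by (simp add: LR ij)
qed

end
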